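(* Let $n\ge 1$ and let $f\in S_n=\mathbb C[x_1,x_1^{-1},\dots,x_n,x_n^{-1}]$ be a Laurent polynomial. Let $1\le k\le n$ and suppose that $f$ has vanishing logarithmic Hessian of rank $n-k$, i.e. the logarithmic Hessian matrix $Af=\left((x_i f_{x_i})_{x_j}\right)_{1\le i,j\le n}$ has rank $n-k$ (in particular $\det Af=0$ in $S_n$). Then there is an automorphism $\xi$ of the torus $(\mathbb C^* )^n$ such that $\xi^*f=f\circ\xi\in S_{n-k}$.
   Context: $S_n=\mathbb C[x_1,x_1^{-1},\dots,x_n,x_n^{-1}]$ is the coordinate ring of the torus $(\mathbb C^* )^n$; for $0\le m\le n$, $S_m=\mathbb C[x_1,x_1^{-1},\dots,x_m,x_m^{-1}]$ is regarded as the subring of $S_n$ of Laurent polynomials in the first $m$ variables only ($S_0=\mathbb C$). Subscripts $x_i$ on functions denote partial derivatives. The logarithmic Hessian matrix of $f$ is the $n\times n$ matrix $Af=\left((x_i f_{x_i})_{x_j}\right)_{i,j}$ with entries in $S_n$; $f$ has vanishing logarithmic Hessian if $\det Af=0$ in $S_n$. The rank of $Af$ is its rank over the fraction field of $S_n$ (equivalently, the maximal rank of $Af(x)$ for $x\in(\mathbb C^* )^n$, i.e. the generic rank of the differential of the logarithmic polar map $L_f:(\mathbb C^* )^n\to\mathbb C^n$, $x\mapsto(x_1f_{x_1}(x),\dots,x_nf_{x_n}(x))$). An automorphism of $(\mathbb C^* )^n$ means an automorphism as an algebraic group, i.e. a monomial map $\xi=\xi_A$ for an integer matrix $A=(a_{ij})$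 with $\det A=\pm1$, where $\xi_A(x_1,\dots,x_n)=\left(x_1^{a_{11}}\cdots x_n^{a_{1n}},\dots,x_1^{a_{n1}}\cdots x_n^{a_{nn}}\right)$. It induces $\xi^*:S_n\to S_n$, $\xi^*f=f\circ\xi$. *)

theory Defs
  imports
    "HOL-Analysis.Analysis"
    "HOL-Library.Poly_Mapping"
    "HOL-Computational_Algebra.Polynomial_Factorial"
begin

text \<open>
  The variables are indexed by a nonempty finite linearly ordered type \<open>'n\<close>, so that
  \<open>n = CARD('n)\<close>. The type \<open>'n \<Rightarrow>\<^sub>0 int\<close> is the group of exponent vectors, and the ring of Laurent
  polynomials is its group algebra over the complex numbers; \<open>lookup f a\<close> is the coefficient of the
  monomial with exponent vector \<open>a\<close>. The order on \<open>'n\<close> says which variables come first. It also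
  provides the ordered group structure on exponents from which the library derives that this ring
  is an integral domain.
\<close>

type_synonym 'n laurent = "('n \<Rightarrow>\<^sub>0 int) \<Rightarrow>\<^sub>0 complex"

definition laurent_var :: "'n \<Rightarrow> 'n laurent"
  where "laurent_var i = Poly_Mapping.single (Poly_Mapping.single i 1) 1"

definition laurent_pderiv :: "'n \<Rightarrow> 'n laurent \<Rightarrow> 'n laurent"
  where "laurent_pderiv i f =
    (\<Sum>a\<in>Poly_Mapping.keys f.
      Poly_Mapping.single (a - Poly_Mapping.single i 1)
        (of_int (Poly_Mapping.lookup a i) * Poly_Mapping.lookup f a))"

text \<open>
  The subring of Laurent polynomials in the first \<open>m\<close> variables: \<open>card {..<i}\<close> is the position of
  \<open>i\<close>, counted from \<open>0\<close>.
\<close>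

definition laurent_subring :: "nat \<Rightarrow> ('n::{finite,linorder}) laurent set"
  where "laurent_subring m =
    {f. \<forall>a\<in>Poly_Mapping.keys f. \<forall>i. m \<le> card {..<i} \<longrightarrow> Poly_Mapping.lookup a i = 0}"

definition log_Hessian :: "('n::finite) laurent \<Rightarrow> 'n laurent ^ 'n ^ 'n"
  where "log_Hessian f =
    (\<chi> i j. laurent_pderiv j (laurent_var i * laurent_pderiv i f))"

definition vanishing_log_Hessian :: "('n::finite) laurent \<Rightarrow> bool"
  where "vanishing_log_Hessian f \<longleftrightarrow> det (log_Hessian f) = 0"

definition fract_matrix :: "('a::idom) ^ 'm ^ 'n \<Rightarrow> 'a fract ^ 'm ^ 'n"
  where "fract_matrix M = (\<chi> i j. to_fract (M $ i $ j))"

definition log_Hessian_rank :: "('n::{finite,linorder}) laurent \<Rightarrow> nat"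
  where "log_Hessian_rank f = rank (fract_matrix (log_Hessian f))"

definition torus :: "(complex ^ 'n) set"
  where "torus = {x. \<forall>i. x $ i \<noteq> 0}"

definition laurent_eval :: "('n::finite) laurent \<Rightarrow> complex ^ 'n \<Rightarrow> complex"
  where "laurent_eval f x =
    (\<Sum>a\<in>Poly_Mapping.keys f.
      Poly_Mapping.lookup f a * (\<Prod>i\<in>UNIV. x $ i powi Poly_Mapping.lookup a i))"

definition monomial_map :: "int ^ 'n ^ 'n \<Rightarrow> complex ^ 'n \<Rightarrow> complex ^ ('n::finite)"
  where "monomial_map A x = (\<chi> i. \<Prod>j\<in>UNIV. x $ j powi (A $ i $ j))"

definition torus_automorphism :: "(complex ^ 'n \<Rightarrow> complex ^ ('n::finite)) \<Rightarrow> bool"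
  where "torus_automorphism \<xi> \<longleftrightarrow>
    (\<exists>A :: int ^ 'n ^ 'n. (det A = 1 \<or> det A = - 1) \<and> \<xi> = monomial_map A)"

text \<open>
  Laurent polynomials are determined by their values on the torus, so \<open>g\<close> is the pullback of \<open>f\<close>
  along \<open>\<xi>\<close> exactly if it represents the function \<open>f \<circ> \<xi>\<close> there.
\<close>

definition is_pullback ::
    "(complex ^ 'n \<Rightarrow> complex ^ 'n) \<Rightarrow> ('n::finite) laurent \<Rightarrow> 'n laurent \<Rightarrow> bool"
  where "is_pullback \<xi> f g \<longleftrightarrow> (\<forall>x\<in>torus. laurent_eval g x = laurent_eval f (\<xi> x))"

lemma monomial_map_torus: "monomial_map A x \<in> torus" if "x \<in> torus"
  using that by (simp add: torus_def monomial_map_def power_int_eq_0_iff)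

lemma laurent_eval_superset:
  assumes "finite S" "Poly_Mapping.keys f \<subseteq> S"
  shows "laurent_eval f x =
    (\<Sum>a\<in>S. Poly_Mapping.lookup f a * (\<Prod>i\<in>UNIV. x $ i powi Poly_Mapping.lookup a i))"
  unfolding laurent_eval_def
  by (rule sum.mono_neutral_left) (use assms in \<open>auto simp: in_keys_iff\<close>)

lemma laurent_eval_add: "laurent_eval (f + g) x = laurent_eval f x + laurent_eval g x"
proof -
  let ?S = "Poly_Mapping.keys f \<union> Poly_Mapping.keys g"
  have "Poly_Mapping.keys (f + g) \<subseteq> ?S"
    by (rule Poly_Mapping.keys_add)
  then show ?thesis
    by (simp add: laurent_eval_superset[of ?S] lookup_add distrib_right sum.distrib)
qed

lemma laurent_eval_single:
  "laurent_eval (Poly_Mapping.single a c) x = c * (\<Prod>i\<in>UNIV. x $ i powi Poly_Mapping.lookup a i)"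
  by (simp add: laurent_eval_superset[of "{a}"])

lemma laurent_eval_sum: "laurent_eval (\<Sum>a\<in>S. h a) x = (\<Sum>a\<in>S. laurent_eval (h a) x)"
  by (induction S rule: infinite_finite_induct)
     (simp_all add: laurent_eval_add, simp_all add: laurent_eval_def)

text \<open>The formal partial derivative is the analytic one.\<close>

lemma laurent_eval_pderiv:
  fixes f :: "('n::finite) laurent"
  assumes "x \<in> torus"
  shows "((\<lambda>t. laurent_eval f (\<chi> j. if j = i then t else x $ j))
    has_field_derivative laurent_eval (laurent_pderiv i f) x) (at (x $ i))"
proof -
  have nz: "x $ j \<noteq> 0" for j
    using assms by (simp add: torus_def)
  let ?r = "\<lambda>a. \<Prod>j\<in>UNIV - {i}. x $ j powi Poly_Mapping.lookup a j"
  have eval: "laurent_eval f (\<chi> j. if j = i then t else x $ j) =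
      (\<Sum>a\<in>Poly_Mapping.keys f. Poly_Mapping.lookup f a * (t powi Poly_Mapping.lookup a i * ?r a))" for t
    unfolding laurent_eval_def by (simp add: prod.remove[of UNIV i])
  have pd: "laurent_eval (laurent_pderiv i f) x =
      (\<Sum>a\<in>Poly_Mapping.keys f. Poly_Mapping.lookup f a *
        (of_int (Poly_Mapping.lookup a i) * x $ i powi (Poly_Mapping.lookup a i - 1) * ?r a))"
    unfolding laurent_pderiv_def laurent_eval_sum laurent_eval_single
    by (rule sum.cong)
       (auto simp: prod.remove[of UNIV i] lookup_minus lookup_single when_def mult_ac
             intro!: prod.cong)
  show ?thesis
    unfolding eval pd
    by (auto intro!: derivative_eq_intros sum.cong simp: nz mult_ac)
qed

lemma det_fract_matrix: "det (fract_matrix M) = to_fract (det M)"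
proof -
  have prod: "to_fract (prod h S) = (\<Prod>i\<in>S. to_fract (h i))" for h :: "'c \<Rightarrow> 'a" and S
    by (induction S rule: infinite_finite_induct) simp_all
  have sum: "to_fract (sum h S) = (\<Sum>i\<in>S. to_fract (h i))" for h :: "'c \<Rightarrow> 'a" and S
    by (induction S rule: infinite_finite_induct) simp_all
  have sgn: "to_fract (of_int (sign p)) = of_int (sign p)" for p :: "'b \<Rightarrow> 'b"
    by (simp add: sign_def)
  show ?thesis
    by (simp add: det_def fract_matrix_def sum prod sgn)
qed

lemma rank_less_iff_det_eq_0:
  fixes M :: "'a::field ^ 'n ^ 'n"
  shows "rank M < CARD('n) \<longleftrightarrow> det M = 0"
proof -
  have "vec.dim (rows M) = CARD('n) \<longleftrightarrow> vec.span (rows M) = UNIV"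
    using vec.dim_eq_full[of "rows M"] by (simp add: vec.dimension_def card_cart_basis)
  moreover have "vec.dim (rows M) \<le> CARD('n)"
    using vec.dim_subset_UNIV[of "rows M"] by (simp add: vec.dimension_def card_cart_basis)
  ultimately show ?thesis
    using invertible_det_nz[of M] matrix_left_invertible_span_rows_gen[of M]
    by (auto simp: row_rank_def_gen invertible_left_inverse)
qed

lemma vanishing_log_Hessian_iff_rank:
  fixes f :: "('n::{finite,linorder}) laurent"
  shows "vanishing_log_Hessian f \<longleftrightarrow> log_Hessian_rank f < CARD('n)"
  unfolding vanishing_log_Hessian_def log_Hessian_rank_def rank_less_iff_det_eq_0 det_fract_matrix
  by simp

end

theory Submission
  imports Defs
begin

text \<open>
  Write \<open>f = \<Sum> c\<^sub>a x\<^sup>a\<close> and scale column \<open>j\<close> of the logarithmic Hessian by \<open>x\<^sub>j\<close>, which turns it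
  into the symmetric matrix \<open>\<Sum> c\<^sub>a a a\<^sup>T x\<^sup>a\<close>. A vector \<open>v\<close> in its kernel pairs to zero with every
  exponent \<open>a\<close> of \<open>f\<close>: otherwise order the exponents, let \<open>D\<close> be the largest exponent occurring
  in any \<open>\<langle>a, v\<rangle> x\<^sup>a\<close>, let \<open>m\<close> be the smallest \<open>a\<close> for which it occurs, and pair the
  \<open>x\<^sup>D\<close>-coefficient of the kernel equation with the coefficient vector of \<open>v\<close> at \<open>D - m\<close>. Only
  \<open>a = m\<close> survives, and it contributes \<open>c\<^sub>m\<close> times a nonzero square.

  So the kernel is cut out by linear equations with integer coefficients. While fewer than \<open>k\<close>
  coordinates vanish on the support, a dimension count over the fraction field gives a kernel
  vector that involves only the remaining coordinates; one of its coefficients and a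
  \<open>\<rat>\<close>-linear functional turn it into an integer relation, and Euclid's algorithm turns that
  into one more vanishing coordinate.
\<close>

abbreviation "lookup \<equiv> Poly_Mapping.lookup"
abbreviation "keys \<equiv> Poly_Mapping.keys"
abbreviation "single \<equiv> Poly_Mapping.single"

type_synonym 'n int_vec = "(int, 'n) vec"
type_synonym 'n int_mat = "((int, 'n) vec, 'n) vec"

section \<open>Coefficients of products, derivatives and scaled Hessian entries\<close>

lemma lookup_single_mult:
  fixes p :: "'a::ab_group_add \<Rightarrow>\<^sub>0 'b::semiring_1"
  shows "lookup (single b c * p) e = c * lookup p (e - b)"
proof -
  have "e = b + q \<longleftrightarrow> q = e - b" for q
    by (auto simp: algebra_simps)
  then show ?thesis
    by (simp add: lookup_mult lookup_single when_mult)
qed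

lemma poly_mapping_sum_single:
  "finite S \<Longrightarrow> keys p \<subseteq> S \<Longrightarrow> (\<Sum>a\<in>S. single a (lookup p a)) = p"
  by (rule poly_mapping_eqI) (auto simp: lookup_sum lookup_single when_def in_keys_iff sum.delta)

lemma lookup_mult_keys:
  fixes p q :: "'a::ab_group_add \<Rightarrow>\<^sub>0 'b::semiring_1"
  assumes "finite S" "keys p \<subseteq> S"
  shows "lookup (p * q) e = (\<Sum>a\<in>S. lookup p a * lookup q (e - a))"
proof -
  have "lookup (p * q) e = lookup ((\<Sum>a\<in>S. single a (lookup p a)) * q) e"
    by (simp add: poly_mapping_sum_single assms)
  also have "\<dots> = (\<Sum>a\<in>S. lookup p a * lookup q (e - a))"
    by (simp add: sum_distrib_right lookup_sum lookup_single_mult)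
  finally show ?thesis .
qed

lemma lookup_laurent_pderiv:
  "lookup (laurent_pderiv i f) e =
    of_int (lookup e i + 1) * lookup f (e + single i 1)"
proof -
  have "lookup (laurent_pderiv i f) e = (\<Sum>a\<in>keys f.
      if a = e + single i 1 then of_int (lookup a i) * lookup f a else 0)"
    unfolding laurent_pderiv_def lookup_sum
    by (intro sum.cong) (auto simp: lookup_single when_def algebra_simps)
  then show ?thesis
    by (auto simp: sum.delta lookup_add lookup_single in_keys_iff)
qed

lemma lookup_var_mult_pderiv:
  "lookup (laurent_var i * laurent_pderiv i f) a = of_int (lookup a i) * lookup f a"
  by (simp add: laurent_var_def lookup_single_mult lookup_laurent_pderiv lookup_minus lookup_single)

lemma lookup_var_mult_log_Hessian:
  "lookup (laurent_var j * log_Hessian f $ i $ j) a =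
    of_int (lookup a i) * of_int (lookup a j) * lookup f a"
  by (simp add: log_Hessian_def lookup_var_mult_pderiv)

section \<open>Kernel vectors pair to zero with the exponents\<close>

lemma log_Hessian_kernel:
  fixes f :: "('n::{finite,linorder}) laurent" and v :: "'n \<Rightarrow> 'n laurent"
  assumes ker: "\<And>i. (\<Sum>j\<in>UNIV. laurent_var j * log_Hessian f $ i $ j * v j) = 0"
    and a: "a \<in> keys f"
  shows "(\<Sum>j\<in>UNIV. of_int (lookup a j) * lookup (v j) e) = 0"
proof (rule ccontr)
  define L where "L a e = (\<Sum>j\<in>UNIV. of_int (lookup a j) * lookup (v j) e)" for a e
  define P where "P = {(a, e). a \<in> keys f \<and> L a e \<noteq> 0}"
  assume "(\<Sum>j\<in>UNIV. of_int (lookup a j) * lookup (v j) e) \<noteq> 0"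
  then have ne: "(a, e) \<in> P"
    using a by (simp add: P_def L_def)
  have "P \<subseteq> keys f \<times> (\<Union>j. keys (v j))"
    by (auto simp: P_def L_def in_keys_iff intro!: sum.neutral)
  then have fin: "finite P"
    by (rule finite_subset) auto
  define D where "D = Max ((\<lambda>(a, e). a + e) ` P)"
  have D_ge: "b + d \<le> D" if "(b, d) \<in> P" for b d
    unfolding D_def using that fin by (intro Max_ge) auto
  have "D \<in> (\<lambda>(a, e). a + e) ` P"
    unfolding D_def using ne fin by (intro Max_in) auto
  then obtain b0 d0 where b0: "(b0, d0) \<in> P" "b0 + d0 = D"
    by auto
  define T where "T = {b \<in> keys f. L b (D - b) \<noteq> 0}"
  have "b0 \<in> T"
    using b0 by (auto simp: T_def P_def)
  have finT: "finite T"
    by (simp add: T_def)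
  define m where "m = Min T"
  have mT: "m \<in> T" and m_le: "\<And>b. b \<in> T \<Longrightarrow> m \<le> b"
    using finT \<open>b0 \<in> T\<close> by (auto simp: m_def intro: Min_in)
  have coeff: "(\<Sum>b\<in>keys f. lookup f b * of_int (lookup b i) * L b (D - b)) = 0" for i
  proof -
    have keys: "keys (laurent_var j * log_Hessian f $ i $ j) \<subseteq> keys f" for j
      by (auto simp: in_keys_iff lookup_var_mult_log_Hessian)
    have "0 = lookup (\<Sum>j\<in>UNIV. laurent_var j * log_Hessian f $ i $ j * v j) D"
      by (simp add: ker)
    also have "\<dots> = (\<Sum>j\<in>UNIV. \<Sum>b\<in>keys f.
        of_int (lookup b i) * of_int (lookup b j) * lookup f b * lookup (v j) (D - b))"
      by (simp add: lookup_sum lookup_mult_keys[OF finite_keys keys] lookup_var_mult_log_Hessian)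
    also have "\<dots> = (\<Sum>b\<in>keys f. lookup f b * of_int (lookup b i) * L b (D - b))"
      by (subst sum.swap) (simp add: L_def sum_distrib_left mult_ac)
    finally show ?thesis by simp
  qed
  \<comment> \<open>Weighting the \<open>i\<close>-th equation by
    \<open>lookup (v i) (D - m)\<close> turns the factor \<open>lookup b i\<close> into
    \<open>L b (D - m)\<close>, so the term at \<open>m\<close> becomes a coefficient times a
    square.\<close>
  have "(\<Sum>b\<in>keys f. lookup f b * L b (D - b) * L b (D - m)) =
      (\<Sum>i\<in>UNIV. lookup (v i) (D - m) *
        (\<Sum>b\<in>keys f. lookup f b * of_int (lookup b i) * L b (D - b)))"
    unfolding sum_distrib_left
    by (subst sum.swap) (simp add: L_def[of _ "D - m"] sum_distrib_left sum_distrib_right mult_ac)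
  also have "\<dots> = 0"
    by (simp add: coeff)
  finally have "(\<Sum>b\<in>keys f. lookup f b * L b (D - b) * L b (D - m)) = 0" .
  moreover have "lookup f b * L b (D - b) * L b (D - m) = 0"
    if b: "b \<in> keys f" "b \<noteq> m" for b
  proof (cases "b \<in> T")
    case True
    then have "m < b"
      using m_le b by (simp add: order_less_le)
    \<comment> \<open>The order on exponents is translation invariant, so \<open>m < b\<close>
      pushes this sum past the maximum \<open>D\<close>.\<close>
    then have "D < b + (D - m)"
      by (simp add: algebra_simps)
    then have "(b, D - m) \<notin> P"
      using D_ge[of b "D - m"] by auto
    then show ?thesis
      using b by (simp add: P_def)
  qed (use b in \<open>simp add: T_def\<close>)
  ultimately have "lookup f m * L m (D - m) * L m (D - m) = 0"
    using mT by (subst (asm) sum.remove[of _ m]) (auto simp: T_def intro!: sum.neutral)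
  then show False
    using mT by (auto simp: T_def in_keys_iff)
qed

section \<open>Orthogonal vectors, denominators and integer relations\<close>

text \<open>Distributing the vectors of \<open>Y\<close> over distinct rows of a square matrix
  leaves some row zero. The matrix is then singular, and any nonzero kernel vector serves as
  \<open>w\<close>.\<close>

lemma exists_orthogonal_vector:
  fixes Y :: "('a::field ^ 'n) set"
  assumes "finite Y" "card Y < CARD('n)"
  shows "\<exists>w. w \<noteq> 0 \<and> (\<forall>y\<in>Y. (\<Sum>i\<in>UNIV. y $ i * w $ i) = 0)"
proof -
  obtain h :: "'a ^ 'n \<Rightarrow> 'n" where h: "inj_on h Y"
    using assms by (metis card_le_inj finite_class.finite_UNIV less_imp_le)
  have "h ` Y \<noteq> UNIV"
    using assms card_image[OF h] by auto
  then obtain i0 where i0: "i0 \<notin> h ` Y"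
    by auto
  define P :: "'a ^ 'n ^ 'n" where "P = (\<chi> i. if i \<in> h ` Y then inv_into Y h i else 0)"
  have "det P = 0"
    by (rule det_zero_row(2)[of i0]) (simp add: row_def P_def i0 vec_eq_iff)
  then have "\<not> invertible P"
    by (simp add: invertible_det_nz)
  then obtain w where w: "P *v w = 0" "w \<noteq> 0"
    by (metis invertible_left_inverse matrix_left_invertible_ker)
  have "(\<Sum>i\<in>UNIV. y $ i * w $ i) = 0" if "y \<in> Y" for y
  proof -
    have "(P *v w) $ h y = 0"
      by (simp add: w)
    then show ?thesis
      using that h by (simp add: matrix_vector_mult_def P_def)
  qed
  then show ?thesis
    using w by blast
qed

lemma fract_common_denominator:
  fixes w :: "'n::finite \<Rightarrow> 'a::idom fract"
  obtains d s where "d \<noteq> 0" "\<And>i. to_fract (s i) = to_fract d * w i"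
proof -
  have "\<exists>p q. w i = Fract p q \<and> q \<noteq> 0" for i
    by (cases "w i") auto
  then obtain p q where pq: "\<And>i. w i = Fract (p i) (q i)" "\<And>i. q i \<noteq> 0"
    by metis
  show thesis
  proof (rule that)
    show "prod q UNIV \<noteq> 0"
      by (simp add: pq)
    show "to_fract (p i * prod q (UNIV - {i})) = to_fract (prod q UNIV) * w i" for i
      using pq by (simp add: to_fract_def eq_fract prod.remove[of UNIV i] mult_ac)
  qed
qed

lemma rat_common_denominator:
  fixes r :: "'n::finite \<Rightarrow> rat"
  obtains d :: int and s where "d \<noteq> 0" "\<And>i. of_int (s i) = of_int d * r i"
proof -
  have "\<exists>p q. r i = of_int p / of_int q \<and> q \<noteq> 0" for i
    by (cases "r i") (auto simp: Fract_of_int_quotient)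
  then obtain p q where pq: "\<And>i. r i = of_int (p i) / of_int (q i)" "\<And>i. q i \<noteq> (0::int)"
    by metis
  show thesis
  proof (rule that)
    show "prod q UNIV \<noteq> 0"
      by (simp add: pq)
    show "of_int (p i * prod q (UNIV - {i})) = of_int (prod q UNIV) * r i" for i
      using pq by (simp add: prod.remove[of UNIV i])
  qed
qed

text \<open>A rational linear functional sending \<open>z i0\<close> to 1 carries every integer
  relation among the \<open>z i\<close> to one among rational numbers, not all zero. Clearing
  denominators gives \<open>u\<close>.\<close>

lemma integral_relation_transfer:
  fixes z :: "'n::finite \<Rightarrow> 'a::field_char_0"
  assumes "z i0 \<noteq> 0"
  obtains u :: "'n int_vec" where "u \<noteq> 0"
    "\<And>t :: 'n int_vec. (\<Sum>i\<in>UNIV. of_int (t $ i) * z i) = 0 \<Longrightarrow> (\<Sum>i\<in>UNIV. t $ i * u $ i) = 0"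
proof -
  interpret Q: vector_space_pair "\<lambda>(q::rat) (z::'a). of_rat q * z" "(*) :: rat \<Rightarrow> rat \<Rightarrow> rat"
    by unfold_locales (simp_all add: algebra_simps of_rat_add of_rat_mult)
  have "Q.vs1.independent {z i0}"
    using assms by simp
  from Q.linear_independent_extend[OF this, of "\<lambda>_. 1"]
  obtain \<phi> where lin: "Vector_Spaces.linear (\<lambda>q z. of_rat q * z) (*) \<phi>" and \<phi>1: "\<phi> (z i0) = 1"
    by auto
  interpret \<phi>: Vector_Spaces.linear "\<lambda>(q::rat) (z::'a). of_rat q * z" "(*) :: rat \<Rightarrow> rat \<Rightarrow> rat" \<phi>
    by (rule lin)
  obtain d s where d: "d \<noteq> 0" "\<And>i. of_int (s i) = of_int d * \<phi> (z i)"
    using rat_common_denominator[of "\<lambda>i. \<phi> (z i)"] by metis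
  show thesis
  proof (rule that[of "\<chi> i. s i"])
    have "rat_of_int (s i0) \<noteq> 0"
      using d \<phi>1 by simp
    then show "(\<chi> i. s i) \<noteq> 0"
      by (metis of_int_0 vec_lambda_beta zero_index)
  next
    fix t :: "'n int_vec"
    assume t: "(\<Sum>i\<in>UNIV. of_int (t $ i) * z i) = 0"
    have "of_int (\<Sum>i\<in>UNIV. t $ i * s i) = of_int d * (\<Sum>i\<in>UNIV. of_int (t $ i) * \<phi> (z i))"
      by (simp add: d sum_distrib_left mult_ac)
    also have "(\<Sum>i\<in>UNIV. of_int (t $ i) * \<phi> (z i)) = \<phi> (\<Sum>i\<in>UNIV. of_rat (of_int (t $ i)) * z i)"
      by (simp only: \<phi>.sum \<phi>.scale)
    also have "\<dots> = 0"
      using t by (simp add: \<phi>.zero)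
    finally have "rat_of_int (\<Sum>i\<in>UNIV. t $ i * s i) = 0"
      by simp
    then show "(\<Sum>i\<in>UNIV. t $ i * (\<chi> i. s i) $ i) = 0"
      by (simp only: of_int_eq_0_iff vec_lambda_beta)
  qed
qed

text \<open>
  Euclid's algorithm on the entries of \<open>u\<close>, run by elementary row operations on \<open>T\<close> that
  preserve the pairing with \<open>u\<close>.
\<close>

lemma unimodular_new_zero_coordinate:
  fixes T :: "('n::finite) int_vec set" and u :: "'n int_vec"
  assumes "u \<noteq> 0" "\<And>t. t \<in> T \<Longrightarrow> (\<Sum>i\<in>UNIV. t $ i * u $ i) = 0"
    and "\<And>i. i \<in> Z \<Longrightarrow> u $ i = 0" "\<And>t i. t \<in> T \<Longrightarrow> i \<in> Z \<Longrightarrow> t $ i = 0"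
  shows "\<exists>C :: 'n int_mat. \<exists>l. det C = 1 \<and> l \<notin> Z \<and> (\<forall>t\<in>T. \<forall>i\<in>insert l Z. (C *v t) $ i = 0)"
  using assms
proof (induction "\<Sum>i\<in>UNIV. nat \<bar>u $ i\<bar>" arbitrary: u T rule: less_induct)
  case less
  obtain j where j: "u $ j \<noteq> 0"
    using less.prems(1) by (auto simp: vec_eq_iff)
  show ?case
  proof (cases "\<exists>i. i \<noteq> j \<and> u $ i \<noteq> 0")
    \<comment> \<open>With a single nonzero entry of \<open>u\<close>, at \<open>j\<close>, the
      pairing reduces to \<open>t $ j * u $ j\<close>.\<close>
    case False
    have "t $ j = 0" if "t \<in> T" for t
    proof -
      have "(\<Sum>i\<in>UNIV. t $ i * u $ i) = t $ j * u $ j"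
        by (subst sum.remove[of _ j]) (use False in \<open>auto intro!: sum.neutral\<close>)
      then show ?thesis
        using less.prems(2)[OF that] j by simp
    qed
    moreover have "j \<notin> Z"
      using less.prems(3) j by auto
    ultimately show ?thesis
      using less.prems(4) by (intro exI[of _ "mat 1"] exI[of _ j]) auto
  next
    case True
    then obtain p q where pq: "p \<noteq> q" "u $ p \<noteq> 0" "u $ q \<noteq> 0" "\<bar>u $ q\<bar> \<le> \<bar>u $ p\<bar>"
      using j by (metis linear)
    \<comment> \<open>This sign makes the new entry at \<open>p\<close> have absolute value
      \<open>\<bar>u $ p\<bar> - \<bar>u $ q\<bar>\<close>, so the induction measure drops. The
      entry at \<open>q\<close> is kept, so \<open>u'\<close> stays nonzero.\<close>
    define s where "s = sgn (u $ p) * sgn (u $ q)"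
    define u' where "u' = (\<chi> i. if i = p then u $ p - s * u $ q else u $ i)"
    \<comment> \<open>The contragredient operation: \<open>t $ q\<close> gains
      \<open>s * t $ p\<close>, which compensates for the \<open>s * u $ q\<close> subtracted from
      \<open>u $ p\<close>.\<close>
    define E :: "'n int_mat" where
      "E = (\<chi> k. if k = q then row q (mat 1) + s *s row p (mat 1) else row k (mat 1))"
    have "det E = 1"
      unfolding E_def using pq by (subst det_row_operation) auto
    have E: "(E *v t) $ k = (if k = q then t $ q + s * t $ p else t $ k)" for t k
    proof -
      have "(E *v t) $ k = (\<Sum>i\<in>UNIV. if k = q then (if i = q then t $ q else 0) +
          (if i = p then s * t $ p else 0) else (if i = k then t $ k else 0))"
        unfolding matrix_vector_mult_def vec_lambda_beta
        by (intro sum.cong) (use pq(1) in \<open>auto simp: E_def row_def mat_def\<close>)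
      then show ?thesis
        using pq(1) by (cases "k = q") (simp_all add: sum.distrib)
    qed
    have abs: "\<bar>u $ p - s * u $ q\<bar> < \<bar>u $ p\<bar>"
      using pq by (auto simp: s_def sgn_if split: if_splits)
    have smaller: "(\<Sum>i\<in>UNIV. nat \<bar>u' $ i\<bar>) < (\<Sum>i\<in>UNIV. nat \<bar>u $ i\<bar>)"
      using abs by (intro sum_strict_mono_ex1) (auto simp: u'_def)
    have nz: "u' \<noteq> 0"
      using pq by (auto simp: vec_eq_iff u'_def)
    have pqZ: "p \<notin> Z" "q \<notin> Z"
      using pq less.prems(3) by auto
    have orth: "(\<Sum>i\<in>UNIV. t' $ i * u' $ i) = 0" if "t' \<in> (*v) E ` T" for t'
    proof -
      obtain t where t: "t \<in> T" "t' = E *v t"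
        using \<open>t' \<in> _\<close> by auto
      have "t' $ i * u' $ i = t $ i * u $ i +
          ((if i = q then s * t $ p * u $ q else 0) - (if i = p then t $ p * s * u $ q else 0))" for i
        using pq(1) by (auto simp: t E u'_def algebra_simps)
      then have "(\<Sum>i\<in>UNIV. t' $ i * u' $ i) = (\<Sum>i\<in>UNIV. t $ i * u $ i)"
        by (simp add: sum.distrib sum_subtractf)
      then show ?thesis
        using less.prems(2) t by simp
    qed
    have "\<exists>C :: 'n int_mat. \<exists>l. det C = 1 \<and> l \<notin> Z \<and>
        (\<forall>t\<in>(*v) E ` T. \<forall>i\<in>insert l Z. (C *v t) $ i = 0)"
      by (rule less.hyps[OF smaller nz orth])
        (use pqZ less.prems(3,4) in \<open>auto simp: u'_def E\<close>)
    then obtain C l where C: "det C = 1" "l \<notin> Z"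
      "\<And>t i. t \<in> T \<Longrightarrow> i \<in> insert l Z \<Longrightarrow> (C *v (E *v t)) $ i = 0"
      by auto
    show ?thesis
      using C \<open>det E = 1\<close>
      by (intro exI[of _ "C ** E"] exI[of _ l]) (simp add: det_mul matrix_vector_mul_assoc)
  qed
qed

section \<open>Vanishing coordinates on the support of \<open>f\<close>\<close>

definition exponent_vector :: "('n::finite \<Rightarrow>\<^sub>0 int) \<Rightarrow> 'n int_vec"
  where "exponent_vector a = (\<chi> i. lookup a i)"

text \<open>Supplies the vector on which Euclid's algorithm runs, when \<open>B\<close> is the
  coordinate change reached so far and \<open>Z\<close> its vanishing coordinates. The rank and
  \<open>Z\<close> together impose fewer than \<open>n\<close> linear conditions.\<close>

lemma integral_relation_of_log_Hessian_rank:
  fixes f :: "('n::{finite,linorder}) laurent" and B :: "'n int_mat"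
  assumes "log_Hessian_rank f + card Z < CARD('n)"
  obtains u :: "'n int_vec" where "u \<noteq> 0" "\<And>i. i \<in> Z \<Longrightarrow> u $ i = 0"
    "\<And>a. a \<in> keys f \<Longrightarrow> (\<Sum>i\<in>UNIV. (B *v exponent_vector a) $ i * u $ i) = 0"
proof -
  let ?M = "fract_matrix (log_Hessian f)"
  \<comment> \<open>\<open>R\<close> is \<open>B\<close> times the diagonal matrix of the variables.
    Orthogonality of \<open>w\<close> to \<open>R *v y\<close> for all rows \<open>y\<close>
    therefore says that the transpose of \<open>B\<close> sends \<open>w\<close> into the kernel of
    the scaled Hessian.\<close>
  define R :: "(('n laurent fract, 'n) vec, 'n) vec"
    where "R = (\<chi> l j. to_fract (of_int (B $ l $ j) * laurent_var j))"
  obtain Y where Y: "Y \<subseteq> rows ?M" "rows ?M \<subseteq> vec.span Y" "card Y = log_Hessian_rank f"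
    using vec.basis_exists[of "rows ?M"] unfolding log_Hessian_rank_def row_rank_def_gen by metis
  have finY: "finite Y"
    by (rule finite_subset[OF Y(1)]) (simp add: rows_def full_SetCompr_eq)
  \<comment> \<open>The unit vectors force \<open>w\<close> to vanish on \<open>Z\<close>; the
    others only need to cover a basis of the row space.\<close>
  let ?W = "(*v) R ` Y \<union> (\<lambda>i. axis i 1) ` Z"
  have "card ?W \<le> card Y + card Z"
    using finY by (intro order.trans[OF card_Un_le] add_mono card_image_le) auto
  then obtain w where w: "w \<noteq> 0" "\<And>y. y \<in> ?W \<Longrightarrow> (\<Sum>i\<in>UNIV. y $ i * w $ i) = 0"
    using exists_orthogonal_vector[of ?W] assms finY Y(3) by auto
  have wZ: "w $ i = 0" if "i \<in> Z" for i
    using w(2)[of "axis i 1"] that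
    by (simp add: axis_def if_distrib[of "\<lambda>x. x * _"] sum.delta cong: if_cong)
  have wR: "(\<Sum>i\<in>UNIV. (R *v y) $ i * w $ i) = 0" if "y \<in> vec.span Y" for y
    using that
  proof (induction rule: vec.span_induct_alt)
    case base
    show ?case by simp
  next
    case (step c x y)
    have "(R *v (c *s x + y)) $ i = c * (R *v x) $ i + (R *v y) $ i" for i
      by (simp add: vec.add vec.scale)
    then have "(\<Sum>i\<in>UNIV. (R *v (c *s x + y)) $ i * w $ i) =
        c * (\<Sum>i\<in>UNIV. (R *v x) $ i * w $ i) + (\<Sum>i\<in>UNIV. (R *v y) $ i * w $ i)"
      by (simp add: distrib_right sum.distrib sum_distrib_left mult.assoc)
    then show ?case
      using step w(2)[of "R *v x"] by simp
  qed
  obtain d s where d: "d \<noteq> 0" "\<And>i. to_fract (s i) = to_fract d * w $ i"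
    using fract_common_denominator[of "\<lambda>i. w $ i"] by metis
  \<comment> \<open>With \<open>v\<close> the transpose of \<open>B\<close> applied to
    \<open>s\<close>, pairing \<open>a\<close> with \<open>v\<close> equals pairing
    \<open>B *v exponent_vector a\<close> with \<open>s\<close>.\<close>
  define v where "v j = (\<Sum>l\<in>UNIV. of_int (B $ l $ j) * s l)" for j
  have to_fract_sum: "to_fract (sum h S) = (\<Sum>i\<in>S. to_fract (h i))"
    for h :: "'n \<Rightarrow> 'n laurent" and S
    by (induction S rule: infinite_finite_induct) simp_all
  have ker: "(\<Sum>j\<in>UNIV. laurent_var j * log_Hessian f $ i $ j * v j) = 0" for i
  proof -
    have "row i ?M \<in> vec.span Y"
      using Y(2) by (auto simp: rows_def)
    from wR[OF this] have "0 = to_fract d * (\<Sum>l\<in>UNIV. (R *v row i ?M) $ l * w $ l)"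
      by simp
    also have "\<dots> = (\<Sum>l\<in>UNIV. (R *v row i ?M) $ l * to_fract (s l))"
      by (simp add: sum_distrib_left d mult_ac)
    also have "\<dots> = to_fract (\<Sum>l\<in>UNIV. \<Sum>j\<in>UNIV.
        of_int (B $ l $ j) * laurent_var j * log_Hessian f $ i $ j * s l)"
      by (simp add: to_fract_sum R_def matrix_vector_mult_def row_def fract_matrix_def
          sum_distrib_right)
    also have "(\<Sum>l\<in>UNIV. \<Sum>j\<in>UNIV.
        of_int (B $ l $ j) * laurent_var j * log_Hessian f $ i $ j * s l) =
        (\<Sum>j\<in>UNIV. laurent_var j * log_Hessian f $ i $ j * v j)"
      by (subst sum.swap) (simp add: v_def sum_distrib_left mult_ac)
    finally show ?thesis
      by (rule iffD1[OF to_fract_eq_0_iff, OF sym])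
  qed
  obtain i0 where "w $ i0 \<noteq> 0"
    using w(1) by (auto simp: vec_eq_iff)
  then have "s i0 \<noteq> 0"
    using d by (metis mult_eq_0_iff to_fract_eq_0_iff)
  \<comment> \<open>Extracting one coefficient of each \<open>s i\<close> passes from Laurent
    polynomials to a nonzero complex vector.\<close>
  then obtain e where e: "lookup (s i0) e \<noteq> 0"
    by (metis lookup_zero poly_mapping_eqI)
  obtain u :: "'n int_vec" where u: "u \<noteq> 0" "\<And>t :: 'n int_vec.
      (\<Sum>i\<in>UNIV. of_int (t $ i) * lookup (s i) e) = 0 \<Longrightarrow> (\<Sum>i\<in>UNIV. t $ i * u $ i) = 0"
    using integral_relation_transfer[of "\<lambda>i. lookup (s i) e", OF e] by metis
  show thesis
  proof (rule that[OF u(1)])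
    fix i
    assume "i \<in> Z"
    then have "s i = 0"
      using d wZ by (metis mult_zero_right to_fract_eq_0_iff)
    \<comment> \<open>Since \<open>s i = 0\<close>, the unit vector at \<open>i\<close> is itself an
      integer relation, and it transfers to \<open>u\<close>.\<close>
    then show "u $ i = 0"
      using u(2)[of "axis i 1"]
      by (simp add: axis_def if_distrib[of "\<lambda>x. x * _"] if_distrib[of of_int] sum.delta cong: if_cong)
  next
    fix a
    assume a: "a \<in> keys f"
    have lookup_of_int_mult: "lookup (of_int c * g) e = of_int c * lookup g e" for c and g :: "'n laurent"
      using lookup_single_mult[of 0 "of_int c" g e] by (simp add: single_of_int)
    have "(\<Sum>i\<in>UNIV. of_int ((B *v exponent_vector a) $ i) * lookup (s i) e) =
        (\<Sum>i\<in>UNIV. \<Sum>j\<in>UNIV. of_int (B $ i $ j) * of_int (lookup a j) * lookup (s i) e)"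
      by (simp add: matrix_vector_mult_def exponent_vector_def sum_distrib_right)
    also have "\<dots> = (\<Sum>j\<in>UNIV. of_int (lookup a j) * lookup (v j) e)"
      by (subst sum.swap, simp add: v_def lookup_sum lookup_of_int_mult sum_distrib_left)
        (simp add: mult_ac)
    also have "\<dots> = 0"
      by (rule log_Hessian_kernel[OF ker a])
    finally show "(\<Sum>i\<in>UNIV. (B *v exponent_vector a) $ i * u $ i) = 0"
      by (rule u(2))
  qed
qed

text \<open>Each induction step finds a relation among the coordinates given by \<open>B\<close> and
  composes \<open>B\<close> with the matrix \<open>C\<close> that turns it into a new zero
  coordinate outside \<open>Z\<close>.\<close>

lemma unimodular_zero_coordinates:
  fixes f :: "('n::{finite,linorder}) laurent"
  assumes "m + log_Hessian_rank f \<le> CARD('n)"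
  shows "\<exists>B :: 'n int_mat. \<exists>Z. det B = 1 \<and> card Z = m \<and>
    (\<forall>a\<in>keys f. \<forall>i\<in>Z. (B *v exponent_vector a) $ i = 0)"
  using assms
proof (induction m)
  case 0
  show ?case
    by (intro exI[of _ "mat 1"] exI[of _ "{}"]) simp
next
  case (Suc m)
  then obtain B :: "'n int_mat" and Z where B: "det B = 1" "card Z = m"
    "\<And>a i. a \<in> keys f \<Longrightarrow> i \<in> Z \<Longrightarrow> (B *v exponent_vector a) $ i = 0"
    by auto
  have less: "log_Hessian_rank f + card Z < CARD('n)"
    using Suc.prems B(2) by simp
  obtain u :: "'n int_vec" where u: "u \<noteq> 0" "\<And>i. i \<in> Z \<Longrightarrow> u $ i = 0"
    "\<And>a. a \<in> keys f \<Longrightarrow> (\<Sum>i\<in>UNIV. (B *v exponent_vector a) $ i * u $ i) = 0"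
    by (rule integral_relation_of_log_Hessian_rank[OF less, where B = B]) blast
  have "\<exists>C :: 'n int_mat. \<exists>l. det C = 1 \<and> l \<notin> Z \<and>
      (\<forall>t\<in>(\<lambda>a. B *v exponent_vector a) ` keys f. \<forall>i\<in>insert l Z. (C *v t) $ i = 0)"
    by (rule unimodular_new_zero_coordinate[OF u(1)]) (use u B in auto)
  then obtain C :: "'n int_mat" and l where "det C = 1" "l \<notin> Z"
    "\<And>a i. a \<in> keys f \<Longrightarrow> i \<in> insert l Z \<Longrightarrow> (C *v (B *v exponent_vector a)) $ i = 0"
    by blast
  then show ?case
    using B by (intro exI[of _ "C ** B"] exI[of _ "insert l Z"])
      (simp add: det_mul matrix_vector_mul_assoc)
qed

section \<open>Moving the zeros to the last variables and pulling back\<close>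

text \<open>The vanishing coordinates may sit anywhere, while \<open>laurent_subring\<close> wants
  them last. An injection of \<open>L\<close> into \<open>Z\<close> extends to a permutation because
  the complements of \<open>L\<close> and of its image have equal size.\<close>

lemma exists_permutation_image_subset:
  fixes L Z :: "'n::finite set"
  assumes "card L \<le> card Z"
  obtains p where "p permutes UNIV" "p ` L \<subseteq> Z"
proof -
  obtain g where g: "inj_on g L" "g ` L \<subseteq> Z"
    using card_le_inj[of L Z] assms by auto
  have "card (- L) = card (- g ` L)"
    by (simp add: Compl_eq_Diff_UNIV card_Diff_subset card_image[OF g(1)])
  then obtain h where h: "bij_betw h (- L) (- g ` L)"
    using finite_same_card_bij[of "- L" "- g ` L"] by auto
  define p where "p i = (if i \<in> L then g i else h i)" for i
  have "bij_betw p (L \<union> - L) (g ` L \<union> - g ` L)"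
    using g(1) h by (intro bij_betw_combine) (auto simp: p_def bij_betw_def inj_on_def)
  then have "p permutes UNIV"
    by (intro bij_imp_permutes) (simp_all add: Compl_partition)
  moreover have "p ` L \<subseteq> Z"
    using g by (auto simp: p_def)
  ultimately show thesis
    by (rule that)
qed

text \<open>Positions are distinct numbers below \<open>n\<close>, and only \<open>k\<close> of
  those are at least \<open>n - k\<close>.\<close>

lemma card_final_positions:
  assumes "k \<le> CARD('n::{finite,linorder})"
  shows "card {i::'n. CARD('n) - k \<le> card {..<i}} \<le> k"
proof -
  have less: "card {..<i} < card {..<j}" if "i < j" for i j :: 'n
    using that by (intro psubset_card_mono) auto
  then have "inj (\<lambda>i::'n. card {..<i})"
    by (intro linorder_injI less_imp_neq)
  moreover have "card {..<i} < CARD('n)" for i :: 'n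
    by (intro psubset_card_mono) auto
  ultimately have "card {i::'n. CARD('n) - k \<le> card {..<i}} \<le> card {CARD('n) - k..<CARD('n)}"
    by (intro card_inj_on_le[of "\<lambda>i. card {..<i}"]) (auto intro: inj_on_subset)
  then show ?thesis
    using assms by simp
qed

text \<open>Pullback acts on exponents by the transposed matrix, which is why the automorphism below
  is built from \<open>transpose C\<close>.\<close>

lemma monomial_at_monomial_map:
  assumes "x \<in> torus"
  shows "(\<Prod>i\<in>UNIV. monomial_map A x $ i powi b $ i) = (\<Prod>j\<in>UNIV. x $ j powi (transpose A *v b) $ j)"
proof -
  have nz: "x $ j \<noteq> 0" for j
    using assms by (simp add: torus_def)
  have prod_powi: "prod h S powi c = (\<Prod>i\<in>S. h i powi c)"
    for h :: "'a \<Rightarrow> complex" and S and c :: int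
    by (induction S rule: infinite_finite_induct) (auto simp: power_int_mult_distrib)
  have powi_sum: "z powi (sum h S) = (\<Prod>i\<in>S. z powi h i)"
    if "z \<noteq> 0" for z :: complex and h :: "'a \<Rightarrow> int" and S
    using that by (induction S rule: infinite_finite_induct) (auto simp: power_int_add)
  have "(\<Prod>i\<in>UNIV. monomial_map A x $ i powi b $ i) =
      (\<Prod>i\<in>UNIV. \<Prod>j\<in>UNIV. x $ j powi (A $ i $ j * b $ i))"
    by (simp add: monomial_map_def prod_powi power_int_mult)
  also have "\<dots> = (\<Prod>j\<in>UNIV. x $ j powi (transpose A *v b) $ j)"
    by (subst prod.swap) (simp add: matrix_vector_mult_def transpose_def powi_sum nz)
  finally show ?thesis .
qed

theorem theorem1:
  fixes f :: "('n::{finite,linorder}) laurent" and k :: nat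
  assumes "1 \<le> k" and "k \<le> CARD('n)"
    and "log_Hessian_rank f = CARD('n) - k"
  shows "\<exists>\<xi>. torus_automorphism \<xi> \<and>
    (\<exists>g \<in> laurent_subring (CARD('n) - k). is_pullback \<xi> f g)"
proof -
  let ?L = "{i::'n. CARD('n) - k \<le> card {..<i}}"
  obtain B :: "'n int_mat" and Z where B: "det B = 1" "card Z = k"
    "\<And>a i. a \<in> keys f \<Longrightarrow> i \<in> Z \<Longrightarrow> (B *v exponent_vector a) $ i = 0"
    using unimodular_zero_coordinates[of k f] assms by auto
  obtain p where p: "p permutes UNIV" "p ` ?L \<subseteq> Z"
    using exists_permutation_image_subset[of ?L Z] card_final_positions assms(2) B(2) by metis
  \<comment> \<open>Row \<open>i\<close> of \<open>C\<close> is row \<open>p i\<close> of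
    \<open>B\<close>, so coordinates in \<open>?L\<close> read off zeros in \<open>Z\<close>; the
    determinant changes at most by a sign.\<close>
  define C :: "'n int_mat" where "C = (\<chi> i. B $ p i)"
  have det: "det (transpose C) = 1 \<or> det (transpose C) = - 1"
    using det_permute_rows[OF p(1), of B] B(1) by (simp add: det_transpose C_def sign_def)
  \<comment> \<open>Every function on the finite type \<open>'n\<close> has finite support, so
    \<open>Abs_poly_mapping\<close> loses nothing.\<close>
  define b where "b a = Abs_poly_mapping (\<lambda>i. (C *v exponent_vector a) $ i)" for a
  have b: "lookup (b a) i = (C *v exponent_vector a) $ i" for a i
    by (simp add: b_def)
  define g where "g = (\<Sum>a\<in>keys f. single (b a) (lookup f a))"
  have "keys g \<subseteq> b ` keys f"
    unfolding g_def by (rule order.trans[OF keys_sum]) (auto split: if_splits)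
  moreover have "lookup (b a) i = 0" if "a \<in> keys f" "i \<in> ?L" for a i
  proof -
    have "lookup (b a) i = (B *v exponent_vector a) $ p i"
      by (simp add: b C_def matrix_vector_mult_def)
    then show ?thesis
      using B(3) p(2) that by auto
  qed
  ultimately have "g \<in> laurent_subring (CARD('n) - k)"
    by (auto simp: laurent_subring_def)
  moreover have "is_pullback (monomial_map (transpose C)) f g"
    unfolding is_pullback_def
  proof
    fix x :: "(complex, 'n) vec"
    assume x: "x \<in> torus"
    show "laurent_eval g x = laurent_eval f (monomial_map (transpose C) x)"
      unfolding g_def laurent_eval_sum laurent_eval_single laurent_eval_def[of f]
      using monomial_at_monomial_map[OF x, of "transpose C" "exponent_vector _"]
      by (simp add: b exponent_vector_def)
  qed
  moreover have "torus_automorphism (monomial_map (transpose C))"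
    unfolding torus_automorphism_def using det by blast
  ultimately show ?thesis
    by blast
qed

end
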